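(* Let $J,K$ be fixed positive integers and let $p\in(0,1]$ be given. Let $(\boldsymbol\Lambda^*,\boldsymbol\Phi^*,\boldsymbol\Omega^* )$ be the true parameters, where $\boldsymbol\Lambda^*\in\mathbb R^{J\times K}$, $\boldsymbol\Phi^*$ is a $K\times K$ symmetric positive definite matrix with unit diagonal, and $\boldsymbol\Omega^*$ is a $J\times J$ diagonal covariance matrix. For each sample size $N$, let $(\hat{\mathbf A}_N,\mathbf I,\hat{\boldsymbol\Omega}_N)$ be an initial (random) estimator, with $\hat{\mathbf A}_N\in\mathbb R^{J\times K}$ and $\hat{\boldsymbol\Omega}_N$ a $J\times J$ diagonal matrix. Suppose that: (C1) $\hat{\mathbf A}_N\hat{\mathbf A}_N'\to\boldsymbol\Lambda^*\boldsymbol\Phi^*\boldsymbol\Lambda^{*\prime}$ and $\hat{\boldsymbol\Omega}_N\to\boldsymbol\Omega^*$ in probability as $N\to\infty$; (C2) $\operatorname{rank}(\boldsymbol\Lambda^*\boldsymbol\Phi^*\boldsymbol\Lambda^{*\prime})=K$; (C3) $(\boldsymbol\Lambda^*,\boldsymbol\Phi^* )$ minimises $Q_p(\boldsymbol\Lambda)$ over all admissible pairs $(\boldsymbol\Lambda,\boldsymbol\Phi)$ with $\boldsymbol\Lambda\boldsymbol\Phi\boldsymbol\Lambda'=\boldsymbol\Lambda^*\boldsymbol\Phi^*\boldsymbol\Lambda^{*\prime}$, and for any other minimiser $(\boldsymbol\Lambda^\dagger,\boldsymbol\Phi^\dagger)$ of this problem there exist $\mathbf D\in\mathcal D_1$ and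 $\tilde{\mathbf D}\in\mathcal D_2$ such that $\boldsymbol\Lambda^\dagger\mathbf D\tilde{\mathbf D}=\boldsymbol\Lambda^*$ and $\tilde{\mathbf D}^{-1}\mathbf D^{-1}\boldsymbol\Phi^\dagger(\mathbf D^{-1})'(\tilde{\mathbf D}^{-1})'=\boldsymbol\Phi^*$. Let $$(\hat{\boldsymbol\Lambda}_{N,p},\hat{\boldsymbol\Phi}_{N,p})\in\arg\min_{\boldsymbol\Lambda,\boldsymbol\Phi}Q_p(\boldsymbol\Lambda)\quad\text{over admissible pairs } (\boldsymbol\Lambda,\boldsymbol\Phi)\text{ such that } \boldsymbol\Lambda\boldsymbol\Phi\boldsymbol\Lambda'=\hat{\mathbf A}_N\hat{\mathbf A}_N'.$$ Then there exist (random) $\mathbf D_N\in\mathcal D_1$ and $\tilde{\mathbf D}_N\in\mathcal D_2$ such that, as $N\to\infty$, $$\hat{\boldsymbol\Lambda}_{N,p}\mathbf D_N\tilde{\mathbf D}_N\to\boldsymbol\Lambda^*\quad\text{and}\quad \tilde{\mathbf D}_N^{-1}\mathbf D_N^{-1}\hat{\boldsymbol\Phi}_{N,p}(\mathbf D_N^{-1})'(\tilde{\mathbf D}_N^{-1})'\to\boldsymbol\Phi^*$$ in probability.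
   Context: A prime denotes matrix transpose. For $\boldsymbol\Lambda=(\lambda_{jk})\in\mathbb R^{J\times K}$, $Q_p(\boldsymbol\Lambda)=\sum_{j=1}^J\sum_{k=1}^K|\lambda_{jk}|^p$. A pair $(\boldsymbol\Lambda,\boldsymbol\Phi)$ is called admissible if $\boldsymbol\Lambda\in\mathbb R^{J\times K}$ and $\boldsymbol\Phi\in\mathbb R^{K\times K}$ is symmetric positive definite with $\phi_{kk}=1$ for $k=1,\dots,K$. $\mathcal D_1$ is the set of all $K\times K$ permutation matrices; $\mathcal D_2$ is the set of all $K\times K$ sign flip matrices, i.e. diagonal matrices with diagonal entries in $\{-1,1\}$. Background: the model is the linear factor model with $J$ manifest variables and $K$ (known) factors, in which the manifest vector has covariance $\boldsymbol\Lambda\boldsymbol\Phi\boldsymbol\Lambda'+\boldsymbol\Omega$; the initial estimator is computed from a sample of size $N$ with the factor covariance constrained to be $\mathbf I$. *)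

theory Defs
  imports "HOL-Probability.Probability"
begin

definition Q_p :: "real \<Rightarrow> real ^ 'k ^ 'j \<Rightarrow> real" where
  "Q_p p L = (\<Sum>j\<in>UNIV. \<Sum>k\<in>UNIV. \<bar>L $ j $ k\<bar> powr p)"

definition diagonal_matrix :: "real ^ 'n ^ 'n \<Rightarrow> bool" where
  "diagonal_matrix A \<longleftrightarrow> (\<forall>i j. i \<noteq> j \<longrightarrow> A $ i $ j = 0)"

definition sym_pos_def :: "real ^ 'n ^ 'n \<Rightarrow> bool" where
  "sym_pos_def A \<longleftrightarrow> transpose A = A \<and> (\<forall>x. x \<noteq> 0 \<longrightarrow> x \<bullet> (A *v x) > 0)"

(* Symmetric positive semidefinite; singular covariances are allowed. *)
definition covariance_matrix :: "real ^ 'n ^ 'n \<Rightarrow> bool" where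
  "covariance_matrix A \<longleftrightarrow> transpose A = A \<and> (\<forall>x. x \<bullet> (A *v x) \<ge> 0)"

definition admissible :: "real ^ 'k ^ 'j \<Rightarrow> real ^ 'k ^ 'k \<Rightarrow> bool" where
  "admissible L \<Phi> \<longleftrightarrow> sym_pos_def \<Phi> \<and> (\<forall>k. \<Phi> $ k $ k = 1)"

definition Q_p_minimiser ::
    "real \<Rightarrow> real ^ 'j ^ 'j \<Rightarrow> real ^ 'k ^ 'j \<Rightarrow> real ^ 'k ^ 'k \<Rightarrow> bool" where
  "Q_p_minimiser p S L \<Phi> \<longleftrightarrow>
     is_arg_min (\<lambda>(L, \<Phi>). Q_p p L)
       (\<lambda>(L, \<Phi>). admissible L \<Phi> \<and> L ** \<Phi> ** transpose L = S) (L, \<Phi>)"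

definition permutation_matrices :: "(real ^ 'k ^ 'k) set" where
  "permutation_matrices =
     {(\<chi> i j. if j = \<sigma> i then 1 else 0) | \<sigma>. \<sigma> permutes UNIV}"

definition sign_flip_matrices :: "(real ^ 'k ^ 'k) set" where
  "sign_flip_matrices = {A. diagonal_matrix A \<and> (\<forall>k. A $ k $ k \<in> {-1, 1})}"

(* Intended for Borel measurable X N; otherwise the events need not be measurable and
   measure would assign them 0. For matrices, dist is the Frobenius distance. *)
definition conv_in_prob :: "'w measure \<Rightarrow> (nat \<Rightarrow> 'w \<Rightarrow> 'a::metric_space) \<Rightarrow> 'a \<Rightarrow> bool" where
  "conv_in_prob M X c \<longleftrightarrow>
     (\<forall>\<epsilon>>0. (\<lambda>N. measure M {\<omega> \<in> space M. dist (X N \<omega>) c > \<epsilon>}) \<longlonglongrightarrow> 0)"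

end

theory Submission
  imports Defs
begin

text \<open>
  Compactness argument. If \<open>A\<^sub>n A\<^sub>n' \<longrightarrow> S = L\<^sub>* \<Phi>\<^sub>* L\<^sub>*'\<close>, then along a subsequence \<open>A\<^sub>n \<longrightarrow> A\<^sub>0\<close>, and the rank
  condition forces \<open>A\<^sub>0 = L\<^sub>* T\<close> and \<open>\<Phi>\<^sub>* = T T'\<close> with \<open>T\<close> invertible. Hence \<open>(A\<^sub>n T\<^sup>-\<^sup>1, \<Phi>\<^sub>*)\<close> is feasible
  for \<open>A\<^sub>n A\<^sub>n'\<close> and converges to \<open>(L\<^sub>*, \<Phi>\<^sub>*)\<close>, which bounds the minimisers and shows that every
  limit point of them is again a minimiser for \<open>S\<close>; the same factorization shows that the limiting
  factor covariance is nonsingular. So the minimisers are stable at \<open>S\<close> up to signed permutations,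
  and since there are only finitely many of these, the best one can be selected measurably.
\<close>

section \<open>Limits of matrix expressions\<close>

lemma tendsto_matrix_mult [tendsto_intros]:
  fixes X :: "'a \<Rightarrow> real ^ 'n ^ 'm" and Y :: "'a \<Rightarrow> real ^ 'l ^ 'n"
  assumes "(X \<longlongrightarrow> A) F" "(Y \<longlongrightarrow> B) F"
  shows "((\<lambda>x. X x ** Y x) \<longlongrightarrow> A ** B) F"
  unfolding matrix_matrix_mult_def by (intro tendsto_intros assms)

lemma tendsto_transpose [tendsto_intros]:
  fixes X :: "'a \<Rightarrow> real ^ 'n ^ 'm"
  assumes "(X \<longlongrightarrow> A) F"
  shows "((\<lambda>x. transpose (X x)) \<longlongrightarrow> transpose A) F"
  unfolding transpose_def by (intro tendsto_intros assms)

lemma continuous_on_matrix_mult [continuous_intros]: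
  fixes f :: "'a::topological_space \<Rightarrow> real ^ 'n ^ 'm" and g :: "'a \<Rightarrow> real ^ 'l ^ 'n"
  assumes "continuous_on S f" "continuous_on S g"
  shows "continuous_on S (\<lambda>x. f x ** g x)"
  using assms unfolding continuous_on_def by (auto intro: tendsto_matrix_mult)

lemma continuous_on_transpose [continuous_intros]:
  fixes f :: "'a::topological_space \<Rightarrow> real ^ 'n ^ 'm"
  assumes "continuous_on S f"
  shows "continuous_on S (\<lambda>x. transpose (f x))"
  using assms unfolding continuous_on_def by (auto intro: tendsto_transpose)

text \<open>Continuity at zero entries is where \<open>0 < p\<close> matters: for
  \<open>p = 0\<close> the sum would count nonzero entries and jump.\<close>

lemma tendsto_Q_p:
  assumes "0 < p" "(X \<longlongrightarrow> L) F"
  shows "((\<lambda>x. Q_p p (X x)) \<longlongrightarrow> Q_p p L) F"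
  unfolding Q_p_def using assms(1) by (intro tendsto_intros assms(2)) auto

lemma bounded_range_matrix:
  fixes X :: "nat \<Rightarrow> real ^ 'n ^ 'm"
  assumes "\<And>n i j. \<bar>X n $ i $ j\<bar> \<le> B"
  shows "bounded (range X)"
proof (rule boundedI[where B = "\<Sum>i\<in>(UNIV::'m set). \<Sum>j\<in>(UNIV::'n set). B"])
  fix x assume "x \<in> range X"
  then obtain n where x: "x = X n" by auto
  have "norm (X n) \<le> (\<Sum>i\<in>UNIV. norm (X n $ i))"
    unfolding norm_vec_def by (rule L2_set_le_sum) auto
  also have "\<dots> \<le> (\<Sum>i\<in>UNIV. \<Sum>j\<in>UNIV. \<bar>X n $ i $ j\<bar>)"
    by (intro sum_mono norm_le_l1_cart)
  also have "\<dots> \<le> (\<Sum>i\<in>(UNIV::'m set). \<Sum>j\<in>(UNIV::'n set). B)"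
    by (intro sum_mono assms)
  finally show "norm x \<le> (\<Sum>i\<in>(UNIV::'m set). \<Sum>j\<in>(UNIV::'n set). B)" using x by simp
qed

section \<open>Gram matrices\<close>

lemma matrix_diff_rdistrib:
  fixes A B :: "'a::ring_1 ^ 'n ^ 'm"
  shows "(A - B) ** C = A ** C - B ** C"
  by (simp add: matrix_matrix_mult_def vec_eq_iff sum_subtractf algebra_simps)

lemma gram_diagonal:
  fixes X :: "real ^ 'n ^ 'm"
  shows "(X ** transpose X) $ i $ i = (\<Sum>j\<in>UNIV. (X $ i $ j)\<^sup>2)"
  by (simp add: matrix_matrix_mult_def transpose_def power2_eq_square)

text \<open>The diagonal of a Gram matrix consists of the squared row norms.\<close>

lemma gram_eq_0D:
  fixes X :: "real ^ 'n ^ 'm"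
  assumes "X ** transpose X = 0"
  shows "X = 0"
proof -
  have "(\<Sum>j\<in>UNIV. (X $ i $ j)\<^sup>2) = 0" for i
    using assms gram_diagonal[of X i] by simp
  then have "X $ i $ j = 0" for i j
    by (simp add: sum_nonneg_eq_0_iff)
  then show ?thesis by (simp add: vec_eq_iff)
qed

text \<open>Full rank gives \<open>L\<close> a left inverse \<open>G\<close>. The projection
  \<open>E = mat 1 - L ** G\<close> kills \<open>L\<close>, hence \<open>A ** transpose A\<close>,
  hence \<open>A\<close>, so that \<open>A = L ** (G ** A)\<close>. Definiteness of
  \<open>\<Phi>\<close> is an outcome rather than an input, so a mere limit of admissible
  covariances can be treated.\<close>

lemma gram_factorization:
  fixes L A :: "real ^ 'k ^ 'j" and \<Phi> :: "real ^ 'k ^ 'k"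
  assumes eq: "L ** \<Phi> ** transpose L = A ** transpose A"
    and rank: "rank (A ** transpose A) = CARD('k)"
  obtains T where "invertible T" "A = L ** T" "\<Phi> = T ** transpose T"
proof -
  have full: "inj ((*v) X)" if "rank X \<ge> CARD('k)" for X :: "real ^ 'k ^ 'm"
    using that rank_bound[of X] by (simp add: full_rank_injective[symmetric])
  have "rank (A ** transpose A) \<le> rank L"
    unfolding eq[symmetric] matrix_mul_assoc[symmetric] by (rule rank_mul_le_left)
  then obtain G where G: "G ** L = mat 1"
    using full[of L] rank by (auto simp: matrix_left_invertible_injective[symmetric])
  have G': "transpose L ** transpose G = mat 1"
    by (metis G matrix_transpose_mul transpose_mat)
  define E where "E = mat 1 - L ** G"
  have EL: "E ** L = 0"
    by (simp add: E_def matrix_diff_rdistrib G matrix_mul_assoc[symmetric])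
  have "(E ** A) ** transpose (E ** A) = E ** (A ** transpose A) ** transpose E"
    by (simp add: matrix_transpose_mul matrix_mul_assoc)
  also have "\<dots> = 0"
    unfolding eq[symmetric] by (simp add: matrix_mul_assoc EL)
  finally have "E ** A = 0" by (rule gram_eq_0D)
  then have AT: "A = L ** (G ** A)"
    by (simp add: E_def matrix_diff_rdistrib matrix_mul_assoc)
  have "\<Phi> = (G ** L) ** \<Phi> ** (transpose L ** transpose G)"
    by (simp add: G G')
  also have "\<dots> = G ** (L ** \<Phi> ** transpose L) ** transpose G"
    by (simp only: matrix_mul_assoc)
  also have "\<dots> = (G ** A) ** transpose (G ** A)"
    by (simp only: eq matrix_mul_assoc matrix_transpose_mul)
  finally have \<Phi>: "\<Phi> = (G ** A) ** transpose (G ** A)" .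
  \<comment> \<open>The rank of the square matrix \<open>G ** A\<close> is squeezed up to the number
    of factors.\<close>
  have "rank (A ** transpose A) \<le> rank A" by (rule rank_mul_le_left)
  also have "rank A \<le> rank (G ** A)" by (subst AT) (rule rank_mul_le_right)
  finally have "invertible (G ** A)"
    using full[of "G ** A"] rank
    by (simp add: invertible_left_inverse matrix_left_invertible_injective)
  with AT \<Phi> that show thesis by blast
qed

lemma sym_pos_def_gram:
  fixes T :: "real ^ 'k ^ 'k"
  assumes "invertible T"
  shows "sym_pos_def (T ** transpose T)"
  unfolding sym_pos_def_def
proof (intro conjI allI impI)
  show "transpose (T ** transpose T) = T ** transpose T"
    by (simp add: matrix_transpose_mul)
  fix x :: "real ^ 'k" assume "x \<noteq> 0"
  have inj: "inj ((*v) (transpose T))"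
    using transpose_invertible[OF assms] by (rule inj_matrix_vector_mult)
  have "transpose T *v x \<noteq> 0"
    using \<open>x \<noteq> 0\<close> injD[OF inj, of x 0] by (auto simp del: transpose_matrix_vector)
  then have "0 < (transpose T *v x) \<bullet> (transpose T *v x)" by (simp del: transpose_matrix_vector)
  also have "\<dots> = x \<bullet> ((T ** transpose T) *v x)"
    by (simp add: dot_lmul_matrix matrix_vector_mul_assoc[symmetric])
  finally show "x \<bullet> ((T ** transpose T) *v x) > 0" .
qed

text \<open>Positivity on the test vectors \<open>e_i + e_j\<close> and \<open>e_i - e_j\<close>
  bounds the correlation from both sides. This confines the factor covariances to a compact
  set.\<close>

lemma admissible_entry_le_1:
  fixes \<Phi> :: "real ^ 'k ^ 'k"
  assumes "admissible L \<Phi>"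
  shows "\<bar>\<Phi> $ i $ j\<bar> \<le> 1"
proof (cases "i = j")
  case True
  then show ?thesis using assms by (simp add: admissible_def)
next
  case False
  have pd: "\<And>x. x \<noteq> 0 \<Longrightarrow> x \<bullet> (\<Phi> *v x) > 0"
    and tr: "transpose \<Phi> = \<Phi>" and diag: "\<And>k. \<Phi> $ k $ k = 1"
    using assms by (auto simp: admissible_def sym_pos_def_def)
  have sym: "\<Phi> $ j $ i = \<Phi> $ i $ j"
    by (subst tr[symmetric]) (simp add: transpose_def)
  \<comment> \<open>Only \<open>s = 1\<close> and \<open>s = -1\<close> satisfy
    \<open>s * s = 1\<close>; both are used at the end.\<close>
  have "0 < 2 + 2 * s * \<Phi> $ i $ j" if s: "s * s = 1" for s
  proof -
    define x where "x = axis i 1 + s *\<^sub>R axis j (1::real)"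
    have "x $ i = 1" using False by (simp add: x_def axis_def)
    then have "x \<noteq> 0" by auto
    have "x \<bullet> (\<Phi> *v x) = \<Phi> $ i $ i + s * \<Phi> $ i $ j + s * \<Phi> $ j $ i + (s * s) * \<Phi> $ j $ j"
      by (simp add: x_def matrix_vector_right_distrib matrix_vector_mult_basis
          vector_scaleR_matrix_ac matrix_vector_mult_scaleR inner_add_left inner_add_right inner_axis' column_def algebra_simps)
    also have "\<dots> = 2 + 2 * s * \<Phi> $ i $ j"
      by (simp add: sym diag s)
    finally show ?thesis using pd[OF \<open>x \<noteq> 0\<close>] by simp
  qed
  from this[of 1] this[of "-1"] show ?thesis by simp
qed

section \<open>Stability of the minimisers\<close>

lemma Q_p_minimiser_iff:
  fixes L :: "real ^ 'k ^ 'j"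
  shows "Q_p_minimiser p S L \<Phi> \<longleftrightarrow>
     admissible L \<Phi> \<and> L ** \<Phi> ** transpose L = S \<and>
     (\<forall>(L' :: real ^ 'k ^ 'j) \<Phi>'. admissible L' \<Phi>' \<longrightarrow> L' ** \<Phi>' ** transpose L' = S \<longrightarrow> Q_p p L \<le> Q_p p L')"
  by (auto simp: Q_p_minimiser_def is_arg_min_def not_less)

text \<open>One summand is at most the whole sum. This is the coercivity of \<open>Q_p\<close>:
  bounded values force bounded loadings.\<close>

lemma entry_le_Q_p:
  assumes "0 < p"
  shows "\<bar>L $ j $ k\<bar> \<le> Q_p p L powr (1 / p)"
proof -
  have "\<bar>L $ j $ k\<bar> powr p \<le> (\<Sum>k\<in>UNIV. \<bar>L $ j $ k\<bar> powr p)"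
    by (rule member_le_sum) auto
  also have "\<dots> \<le> Q_p p L"
    unfolding Q_p_def by (rule member_le_sum) (auto intro: sum_nonneg)
  finally have "(\<bar>L $ j $ k\<bar> powr p) powr (1 / p) \<le> Q_p p L powr (1 / p)"
    using assms by (intro powr_mono2) auto
  then show ?thesis using assms by (simp add: powr_powr)
qed

text \<open>The feasible set moves with \<open>n\<close>, so \<open>L_star\<close> cannot be
  compared with \<open>L n\<close> directly. It is replaced by a nearby competitor that is feasible
  for \<open>A n\<close>, and the resulting inequality survives the limit.\<close>

lemma Q_p_minimisers_subconvergent:
  fixes A L :: "nat \<Rightarrow> real ^ 'k ^ 'j" and \<Phi> :: "nat \<Rightarrow> real ^ 'k ^ 'k" and L_star :: "real ^ 'k ^ 'j"
  assumes p: "0 < p" and rank: "rank S = CARD('k)"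
    and star: "Q_p_minimiser p S L_star \<Phi>_star"
    and lim: "(\<lambda>n. A n ** transpose (A n)) \<longlonglongrightarrow> S"
    and min: "\<And>n. Q_p_minimiser p (A n ** transpose (A n)) (L n) (\<Phi> n)"
  obtains r L\<^sub>0 \<Phi>\<^sub>0 where "strict_mono r" "(L \<circ> r) \<longlonglongrightarrow> L\<^sub>0" "(\<Phi> \<circ> r) \<longlonglongrightarrow> \<Phi>\<^sub>0"
    "Q_p_minimiser p S L\<^sub>0 \<Phi>\<^sub>0"
proof -
  obtain B where B: "\<And>n. norm (A n ** transpose (A n)) \<le> B"
    using convergent_imp_Bseq[OF convergentI[OF lim]] by (auto simp: Bseq_def)
  have "\<bar>A n $ j $ k\<bar> \<le> sqrt B" for n j k
  proof -
    \<comment> \<open>The squared entry is one term of the squared norm of row \<open>j\<close>,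
      which is a diagonal entry of the Gram matrix.\<close>
    have "(A n $ j $ k)\<^sup>2 \<le> (A n ** transpose (A n)) $ j $ j"
      unfolding gram_diagonal by (rule member_le_sum) auto
    also have "\<dots> \<le> norm (A n ** transpose (A n))"
      by (rule order_trans[OF abs_ge_self order_trans[OF component_le_norm_cart Finite_Cartesian_Product.norm_nth_le]])
    finally show ?thesis using B[of n] by (intro real_le_rsqrt) simp
  qed
  then have "bounded (range A)" by (rule bounded_range_matrix)
  then obtain r1 A\<^sub>0 where r1: "strict_mono r1" and A\<^sub>0: "(A \<circ> r1) \<longlonglongrightarrow> A\<^sub>0"
    using bounded_imp_convergent_subsequence by blast
  have "(\<lambda>n. A (r1 n) ** transpose (A (r1 n))) \<longlonglongrightarrow> A\<^sub>0 ** transpose A\<^sub>0"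
    using A\<^sub>0 unfolding o_def by (intro tendsto_intros)
  moreover have "(\<lambda>n. A (r1 n) ** transpose (A (r1 n))) \<longlonglongrightarrow> S"
    using LIMSEQ_subseq_LIMSEQ[OF lim r1] by (simp add: o_def)
  ultimately have S: "S = A\<^sub>0 ** transpose A\<^sub>0"
    using LIMSEQ_unique by blast
  obtain T where T: "invertible T" "A\<^sub>0 = L_star ** T" "\<Phi>_star = T ** transpose T"
    using gram_factorization[of L_star \<Phi>_star A\<^sub>0] star rank S
    by (auto simp: Q_p_minimiser_iff)
  obtain U where U: "T ** U = mat 1"
    using T(1) by (auto simp: invertible_def)
  have U2: "U ** T = mat 1"
    using U matrix_left_right_inverse by blast
  have U': "transpose T ** transpose U = mat 1"
    by (metis U2 matrix_transpose_mul transpose_mat)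
  \<comment> \<open>The competitor is \<open>(A n ** U, \<Phi>_star)\<close> with \<open>U\<close>
    the inverse of \<open>T\<close>: the factors \<open>U\<close> and \<open>T\<close> cancel around
    \<open>\<Phi>_star = T ** transpose T\<close>.\<close>
  have comp: "Q_p p (L n) \<le> Q_p p (A n ** U)" for n
  proof -
    have "A n ** U ** \<Phi>_star ** transpose (A n ** U)
        = A n ** (U ** T) ** (transpose T ** transpose U) ** transpose (A n)"
      by (simp only: T(3) matrix_transpose_mul matrix_mul_assoc)
    also have "\<dots> = A n ** transpose (A n)"
      by (simp add: U2 U')
    finally show ?thesis
      using min[of n] star by (auto simp: Q_p_minimiser_iff admissible_def)
  qed
  have "(\<lambda>n. A (r1 n) ** U) \<longlonglongrightarrow> A\<^sub>0 ** U"
    using A\<^sub>0 unfolding o_def by (intro tendsto_intros)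
  also have "A\<^sub>0 ** U = L_star"
    by (simp add: T(2) matrix_mul_assoc[symmetric] U)
  finally have QU: "(\<lambda>n. Q_p p (A (r1 n) ** U)) \<longlonglongrightarrow> Q_p p L_star"
    by (rule tendsto_Q_p[OF p])
  \<comment> \<open>The competitors have convergent, hence bounded, values, and the minimisers do no
    worse.\<close>
  obtain C where C: "\<And>n. norm (Q_p p (A (r1 n) ** U)) \<le> C"
    using convergent_imp_Bseq[OF convergentI[OF QU]] by (auto simp: Bseq_def)
  have "\<bar>L (r1 n) $ j $ k\<bar> \<le> C powr (1 / p)" for n j k
  proof -
    have "\<bar>L (r1 n) $ j $ k\<bar> \<le> Q_p p (L (r1 n)) powr (1 / p)"
      by (rule entry_le_Q_p[OF p])
    also have "\<dots> \<le> C powr (1 / p)"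
    proof (rule powr_mono2)
      show "0 \<le> Q_p p (L (r1 n))" unfolding Q_p_def by (intro sum_nonneg) auto
      show "Q_p p (L (r1 n)) \<le> C" using comp[of "r1 n"] C[of n] by simp
    qed (use p in auto)
    finally show ?thesis .
  qed
  then have bL: "bounded (range (L \<circ> r1))" by (intro bounded_range_matrix) auto
  have "\<bar>\<Phi> n $ i $ j\<bar> \<le> 1" for n i j
    using min[of n] admissible_entry_le_1 by (auto simp: Q_p_minimiser_iff)
  then have b\<Phi>: "bounded (range (\<Phi> \<circ> r1))" by (intro bounded_range_matrix) auto
  \<comment> \<open>Pairing the two sequences lets one extraction serve both.\<close>
  have "bounded (range (\<lambda>n. (L (r1 n), \<Phi> (r1 n))))"
    by (rule bounded_subset[OF bounded_Times[OF bL b\<Phi>]]) auto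
  then obtain l r2 where r2: "strict_mono r2"
    and l: "((\<lambda>n. (L (r1 n), \<Phi> (r1 n))) \<circ> r2) \<longlonglongrightarrow> l"
    using bounded_imp_convergent_subsequence by blast
  define r where "r = r1 \<circ> r2"
  obtain L\<^sub>0 \<Phi>\<^sub>0 where l_eq: "l = (L\<^sub>0, \<Phi>\<^sub>0)" by fastforce
  have r: "strict_mono r" using r1 r2 by (simp add: r_def strict_mono_o)
  have L\<^sub>0: "(\<lambda>n. L (r n)) \<longlonglongrightarrow> L\<^sub>0" and \<Phi>\<^sub>0: "(\<lambda>n. \<Phi> (r n)) \<longlonglongrightarrow> \<Phi>\<^sub>0"
    using tendsto_fst[OF l] tendsto_snd[OF l] by (simp_all add: o_def r_def l_eq)
  have "(\<lambda>n. L (r n) ** \<Phi> (r n) ** transpose (L (r n))) \<longlonglongrightarrow> L\<^sub>0 ** \<Phi>\<^sub>0 ** transpose L\<^sub>0"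
    by (intro tendsto_intros L\<^sub>0 \<Phi>\<^sub>0)
  moreover have "(\<lambda>n. L (r n) ** \<Phi> (r n) ** transpose (L (r n))) \<longlonglongrightarrow> S"
    using LIMSEQ_subseq_LIMSEQ[OF lim r] min by (simp add: o_def Q_p_minimiser_iff)
  ultimately have S\<^sub>0: "L\<^sub>0 ** \<Phi>\<^sub>0 ** transpose L\<^sub>0 = S"
    using LIMSEQ_unique by blast
  have "\<Phi>\<^sub>0 $ k $ k = 1" for k
  proof -
    have "(\<lambda>n. \<Phi> (r n) $ k $ k) \<longlonglongrightarrow> \<Phi>\<^sub>0 $ k $ k"
      by (intro tendsto_intros \<Phi>\<^sub>0)
    moreover have "\<Phi> (r n) $ k $ k = 1" for n
      using min by (auto simp: Q_p_minimiser_iff admissible_def)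
    ultimately show ?thesis by (simp add: LIMSEQ_const_iff)
  qed
  \<comment> \<open>A limit of positive definite matrices could be singular. The factorization of
    \<open>A\<^sub>0\<close> through \<open>L\<^sub>0\<close> rules this out by writing
    \<open>\<Phi>\<^sub>0\<close> as an invertible matrix times its transpose.\<close>
  moreover have "sym_pos_def \<Phi>\<^sub>0"
    using gram_factorization[of L\<^sub>0 \<Phi>\<^sub>0 A\<^sub>0] S\<^sub>0 S rank sym_pos_def_gram by metis
  moreover have "Q_p p L\<^sub>0 \<le> Q_p p L_star"
  proof (rule LIMSEQ_le)
    show "(\<lambda>n. Q_p p (L (r n))) \<longlonglongrightarrow> Q_p p L\<^sub>0" by (rule tendsto_Q_p[OF p L\<^sub>0])
    show "(\<lambda>n. Q_p p (A (r n) ** U)) \<longlonglongrightarrow> Q_p p L_star"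
      using LIMSEQ_subseq_LIMSEQ[OF QU r2] by (simp add: o_def r_def)
  qed (use comp in auto)
  ultimately have "Q_p_minimiser p S L\<^sub>0 \<Phi>\<^sub>0"
    using star S\<^sub>0 unfolding Q_p_minimiser_iff admissible_def by (meson order_trans)
  then show thesis
    using that[OF r] L\<^sub>0 \<Phi>\<^sub>0 by (auto simp: o_def)
qed

section \<open>Alignment by signed permutations\<close>

definition signed_permutations :: "((real ^ 'k ^ 'k) \<times> (real ^ 'k ^ 'k)) set" where
  "signed_permutations = permutation_matrices \<times> sign_flip_matrices"

definition aligned_loadings ::
    "real ^ 'k ^ 'j \<Rightarrow> (real ^ 'k ^ 'k) \<times> (real ^ 'k ^ 'k) \<Rightarrow> real ^ 'k ^ 'j" where
  "aligned_loadings L d = L ** fst d ** snd d"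

text \<open>With \<open>P = fst d ** snd d\<close> invertible, this is the covariance of the factors
  after the change of basis that turns \<open>L\<close> into \<open>L ** P\<close>; the product
  \<open>L ** \<Phi> ** transpose L\<close> is preserved.\<close>

definition aligned_cov ::
    "real ^ 'k ^ 'k \<Rightarrow> (real ^ 'k ^ 'k) \<times> (real ^ 'k ^ 'k) \<Rightarrow> real ^ 'k ^ 'k" where
  "aligned_cov \<Phi> d = matrix_inv (snd d) ** matrix_inv (fst d) ** \<Phi>
     ** transpose (matrix_inv (fst d)) ** transpose (matrix_inv (snd d))"

lemma finite_signed_permutations:
  "finite (signed_permutations :: ((real ^ 'k ^ 'k) \<times> (real ^ 'k ^ 'k)) set)"
proof -
  have "finite {\<sigma> :: 'k \<Rightarrow> 'k. \<sigma> permutes UNIV}" by (simp add: finite_permutations)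
  then have "finite (permutation_matrices :: (real ^ 'k ^ 'k) set)"
    unfolding permutation_matrices_def by (simp add: setcompr_eq_image)
  \<comment> \<open>A sign flip is encoded by the Boolean function marking its positive diagonal
    entries.\<close>
  moreover have "(sign_flip_matrices :: (real ^ 'k ^ 'k) set)
      \<subseteq> range (\<lambda>b. \<chi> i j. if i = j then (if b i then 1 else -1) else 0)"
  proof
    fix A :: "real ^ 'k ^ 'k" assume "A \<in> sign_flip_matrices"
    then have "A = (\<chi> i j. if i = j then (if A $ i $ i = 1 then 1 else -1) else 0)"
      by (auto simp: sign_flip_matrices_def diagonal_matrix_def vec_eq_iff)
    then show "A \<in> range (\<lambda>b. \<chi> i j. if i = j then (if b i then 1 else -1) else 0)"
      by (rule range_eqI[where x = "\<lambda>i. A $ i $ i = 1"])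
  qed
  then have "finite (sign_flip_matrices :: (real ^ 'k ^ 'k) set)"
    by (rule finite_subset) simp
  ultimately show ?thesis by (simp add: signed_permutations_def)
qed

text \<open>This handles the true parameters themselves, since the uniqueness assumption speaks only
  of other minimisers, and it makes the set of alignments nonempty.\<close>

lemma identity_in_signed_permutations: "(mat 1, mat 1) \<in> signed_permutations"
proof -
  have "mat 1 = (\<chi> i j. if j = id i then 1 else (0::real))"
    by (auto simp: mat_def vec_eq_iff)
  then have "mat 1 \<in> permutation_matrices"
    unfolding permutation_matrices_def using permutes_id by blast
  moreover have "mat 1 \<in> sign_flip_matrices"
    by (auto simp: sign_flip_matrices_def diagonal_matrix_def mat_def)
  ultimately show ?thesis by (simp add: signed_permutations_def)
qed

lemma aligned_identity:
  fixes L :: "real ^ 'k ^ 'j" and \<Phi> :: "real ^ 'k ^ 'k"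
  shows "aligned_loadings L (mat 1, mat 1) = L" "aligned_cov \<Phi> (mat 1, mat 1) = \<Phi>"
proof -
  have "matrix_inv (mat 1 :: real ^ 'k ^ 'k) = mat 1"
    unfolding matrix_inv_def by (rule some_equality) auto
  then show "aligned_loadings L (mat 1, mat 1) = L" "aligned_cov \<Phi> (mat 1, mat 1) = \<Phi>"
    by (simp_all add: aligned_loadings_def aligned_cov_def transpose_mat)
qed

text \<open>Adding the two errors forces one and the same \<open>d\<close> to align loadings and
  covariance.\<close>

definition misalignment where
  "misalignment L\<^sub>0 \<Phi>\<^sub>0 L \<Phi> d = dist (aligned_loadings L d) L\<^sub>0 + dist (aligned_cov \<Phi> d) \<Phi>\<^sub>0"

text \<open>If no \<open>\<delta>\<close> worked, a sequence of badly aligned minimisers would have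
  a subsequence converging to a minimiser for \<open>S\<close>. The alignment of that limit, kept
  fixed, also aligns the late members of the subsequence. The \<open>\<delta>\<close> is
  deterministic and uniform in \<open>A\<close>, as the probabilistic step requires.\<close>

lemma Q_p_minimiser_stable:
  fixes S :: "real ^ 'j ^ 'j" and L_star :: "real ^ 'k ^ 'j" and \<Phi>_star :: "real ^ 'k ^ 'k"
  assumes p: "0 < p" and rank: "rank S = CARD('k)"
    and star: "Q_p_minimiser p S L_star \<Phi>_star"
    and unique: "\<And>L \<Phi>. Q_p_minimiser p S L \<Phi> \<Longrightarrow>
      \<exists>d\<in>signed_permutations. aligned_loadings L d = L_star \<and> aligned_cov \<Phi> d = \<Phi>_star"
    and "\<epsilon> > 0"
  shows "\<exists>\<delta>>0. \<forall>(A :: real ^ 'k ^ 'j) L \<Phi>. dist (A ** transpose A) S \<le> \<delta> \<longrightarrow>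
    Q_p_minimiser p (A ** transpose A) L \<Phi> \<longrightarrow>
    (\<exists>d\<in>signed_permutations. misalignment L_star \<Phi>_star L \<Phi> d \<le> \<epsilon>)"
proof (rule ccontr)
  assume neg: "\<not> ?thesis"
  \<comment> \<open>A counterexample to the choice \<open>\<delta> = 1 / (n + 1)\<close>.\<close>
  define bad where "bad n A L \<Phi> \<longleftrightarrow>
      dist ((A :: real ^ 'k ^ 'j) ** transpose A) S \<le> inverse (real (Suc n)) \<and>
      Q_p_minimiser p (A ** transpose A) L \<Phi> \<and>
      (\<forall>d\<in>signed_permutations. \<not> misalignment L_star \<Phi>_star L \<Phi> d \<le> \<epsilon>)" for n A L \<Phi>
  have "\<exists>A L \<Phi>. bad n A L \<Phi>" for n
  proof -
    have "inverse (real (Suc n)) > 0" by simp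
    with neg show ?thesis unfolding bad_def by blast
  qed
  then obtain A L \<Phi> where bad: "\<And>n. bad n (A n) (L n) (\<Phi> n)"
    by metis
  have dist: "dist (A n ** transpose (A n)) S \<le> inverse (real (Suc n))"
    and min: "Q_p_minimiser p (A n ** transpose (A n)) (L n) (\<Phi> n)"
    and far: "d \<in> signed_permutations \<Longrightarrow> misalignment L_star \<Phi>_star (L n) (\<Phi> n) d > \<epsilon>" for n d
    using bad[of n] by (auto simp: bad_def not_le)
  have "(\<lambda>n. A n ** transpose (A n)) \<longlonglongrightarrow> S"
  proof (rule tendsto_dist_iff[THEN iffD2])
    show "(\<lambda>n. dist (A n ** transpose (A n)) S) \<longlonglongrightarrow> 0"
      by (rule real_tendsto_sandwich[OF _ _ tendsto_const LIMSEQ_inverse_real_of_nat])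
         (use dist in \<open>auto simp del: of_nat_Suc\<close>)
  qed
  from Q_p_minimisers_subconvergent[OF p rank star this min]
  obtain r L\<^sub>0 \<Phi>\<^sub>0 where L\<^sub>0: "(L \<circ> r) \<longlonglongrightarrow> L\<^sub>0" and \<Phi>\<^sub>0: "(\<Phi> \<circ> r) \<longlonglongrightarrow> \<Phi>\<^sub>0"
    and "Q_p_minimiser p S L\<^sub>0 \<Phi>\<^sub>0" by blast
  with unique obtain d where d: "d \<in> signed_permutations"
    and "aligned_loadings L\<^sub>0 d = L_star" "aligned_cov \<Phi>\<^sub>0 d = \<Phi>_star" by blast
  then have "misalignment L_star \<Phi>_star L\<^sub>0 \<Phi>\<^sub>0 d = 0"
    by (simp add: misalignment_def)
  \<comment> \<open>For a fixed \<open>d\<close> the misalignment is continuous in loadings and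
    covariance, the inverses being constant matrices.\<close>
  moreover have "(\<lambda>n. misalignment L_star \<Phi>_star (L (r n)) (\<Phi> (r n)) d)
      \<longlonglongrightarrow> misalignment L_star \<Phi>_star L\<^sub>0 \<Phi>\<^sub>0 d"
    unfolding misalignment_def aligned_loadings_def aligned_cov_def
    using L\<^sub>0 \<Phi>\<^sub>0 unfolding o_def by (intro tendsto_intros)
  ultimately have "\<epsilon> \<le> 0"
    using far[OF d] by (intro LIMSEQ_le_const[where x = 0 and a = \<epsilon>]) (auto intro: less_imp_le)
  with \<open>\<epsilon> > 0\<close> show False by simp
qed

section \<open>Measurable alignment\<close>

text \<open>After enumerating \<open>F\<close>, the least minimising index breaks ties; it is
  measurable because it is determined by finitely many comparisons of measurable functions.\<close>

lemma measurable_finite_argmin: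
  fixes g :: "'d \<Rightarrow> 'w \<Rightarrow> real"
  assumes "finite F" "F \<noteq> {}" and meas: "\<And>d. d \<in> F \<Longrightarrow> g d \<in> borel_measurable M"
  obtains s where "s \<in> M \<rightarrow>\<^sub>M count_space F"
    "\<And>\<omega>. \<omega> \<in> space M \<Longrightarrow> s \<omega> \<in> F" "\<And>\<omega> d. d \<in> F \<Longrightarrow> g (s \<omega>) \<omega> \<le> g d \<omega>"
proof -
  obtain e where e: "bij_betw e {..<card F} F"
    using ex_bij_betw_nat_finite[OF \<open>finite F\<close>] by (auto simp: atLeast0LessThan)
  define P where "P i \<omega> \<longleftrightarrow> i < card F \<and> (\<forall>j<card F. g (e i) \<omega> \<le> g (e j) \<omega>)" for i \<omega>
  define n where "n \<omega> = (LEAST i. P i \<omega>)" for \<omega>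
  have eF: "e i \<in> F" if "i < card F" for i
    using e that by (auto simp: bij_betw_def)
  have "P (n \<omega>) \<omega>" for \<omega>
  proof -
    have "{..<card F} \<noteq> {}" using assms(1,2) by (auto simp: lessThan_empty_iff)
    then obtain i where "is_arg_min (\<lambda>i. g (e i) \<omega>) (\<lambda>i. i \<in> {..<card F}) i"
      using ex_is_arg_min_if_finite[of "{..<card F}" "\<lambda>i. g (e i) \<omega>"] by blast
    then have "P i \<omega>" by (auto simp: is_arg_min_def P_def simp flip: not_less)
    then show ?thesis unfolding n_def by (rule LeastI)
  qed
  then have n: "n \<omega> < card F" "\<And>j. j < card F \<Longrightarrow> g (e (n \<omega>)) \<omega> \<le> g (e j) \<omega>" for \<omega>
    by (auto simp: P_def)
  have "P i \<in> M \<rightarrow>\<^sub>M count_space UNIV" for i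
  proof (cases "i < card F")
    case True
    have [measurable]: "g (e j) \<in> borel_measurable M" if "j \<in> {..<card F}" for j
      using that meas eF by auto
    have [measurable]: "g (e i) \<in> borel_measurable M" using True meas eF by auto
    have "(\<lambda>\<omega>. \<forall>j\<in>{..<card F}. g (e i) \<omega> \<le> g (e j) \<omega>) \<in> M \<rightarrow>\<^sub>M count_space UNIV"
      by measurable
    then show ?thesis using True by (simp add: P_def[abs_def] Ball_def)
  qed (simp add: P_def[abs_def])
  then have meas_n: "n \<in> M \<rightarrow>\<^sub>M count_space UNIV"
    unfolding n_def[abs_def] by (rule measurable_Least)
  \<comment> \<open>The index takes values in a discrete space, on which the enumeration is
    trivially measurable.\<close>
  have "(\<lambda>\<omega>. e (n \<omega>)) \<in> M \<rightarrow>\<^sub>M count_space F"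
  proof (rule measurable_compose[where N = "count_space {..<card F}"])
    show "n \<in> M \<rightarrow>\<^sub>M count_space {..<card F}"
      using meas_n n(1) by (auto simp: measurable_count_space_eq2_countable)
  qed (use eF in auto)
  moreover have "g (e (n \<omega>)) \<omega> \<le> g d \<omega>" if d: "d \<in> F" for \<omega> d
  proof -
    obtain j where "j < card F" "d = e j" using e d by (auto simp: bij_betw_def)
    then show ?thesis using n(2) by simp
  qed
  ultimately show thesis using that[of "\<lambda>\<omega>. e (n \<omega>)"] eF n(1) by blast
qed

section \<open>From deterministic stability to convergence in probability\<close>

theorem theorem1:
  fixes M :: "'w measure"
    and p :: real
    and L_star :: "real ^ 'k ^ 'j" and \<Phi>_star :: "real ^ 'k ^ 'k" and \<Omega>_star :: "real ^ 'j ^ 'j"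
    and A_hat :: "nat \<Rightarrow> 'w \<Rightarrow> real ^ 'k ^ 'j" and \<Omega>_hat :: "nat \<Rightarrow> 'w \<Rightarrow> real ^ 'j ^ 'j"
    and L_hat :: "nat \<Rightarrow> 'w \<Rightarrow> real ^ 'k ^ 'j" and \<Phi>_hat :: "nat \<Rightarrow> 'w \<Rightarrow> real ^ 'k ^ 'k"
  assumes "prob_space M"
    and "0 < p" and "p \<le> 1"
    and "sym_pos_def \<Phi>_star" and "\<forall>k. \<Phi>_star $ k $ k = 1"
    and "diagonal_matrix \<Omega>_star" and "covariance_matrix \<Omega>_star"
    and "\<And>N. A_hat N \<in> borel_measurable M" and "\<And>N. \<Omega>_hat N \<in> borel_measurable M"
    and "\<And>N. AE \<omega> in M. diagonal_matrix (\<Omega>_hat N \<omega>)"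
    and C1: "conv_in_prob M (\<lambda>N \<omega>. A_hat N \<omega> ** transpose (A_hat N \<omega>))
               (L_star ** \<Phi>_star ** transpose L_star)"
            "conv_in_prob M \<Omega>_hat \<Omega>_star"
    and C2: "rank (L_star ** \<Phi>_star ** transpose L_star) = CARD('k)"
    and C3: "Q_p_minimiser p (L_star ** \<Phi>_star ** transpose L_star) L_star \<Phi>_star"
            "\<And>L \<Phi>. Q_p_minimiser p (L_star ** \<Phi>_star ** transpose L_star) L \<Phi> \<Longrightarrow>
               (L, \<Phi>) \<noteq> (L_star, \<Phi>_star) \<Longrightarrow>
               \<exists>D\<in>permutation_matrices. \<exists>D'\<in>sign_flip_matrices.
                 L ** D ** D' = L_star \<and>
                 matrix_inv D' ** matrix_inv D ** \<Phi> ** transpose (matrix_inv D)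
                   ** transpose (matrix_inv D') = \<Phi>_star"
    and "\<And>N. L_hat N \<in> borel_measurable M" and "\<And>N. \<Phi>_hat N \<in> borel_measurable M"
    and "\<And>N. AE \<omega> in M.
           Q_p_minimiser p (A_hat N \<omega> ** transpose (A_hat N \<omega>)) (L_hat N \<omega>) (\<Phi>_hat N \<omega>)"
  shows "\<exists>D D' :: nat \<Rightarrow> 'w \<Rightarrow> real ^ 'k ^ 'k.
           (\<forall>N. D N \<in> borel_measurable M) \<and> (\<forall>N. D' N \<in> borel_measurable M) \<and>
           (\<forall>N. \<forall>\<omega>\<in>space M. D N \<omega> \<in> permutation_matrices \<and> D' N \<omega> \<in> sign_flip_matrices) \<and>
           conv_in_prob M (\<lambda>N \<omega>. L_hat N \<omega> ** D N \<omega> ** D' N \<omega>) L_star \<and>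
           conv_in_prob M (\<lambda>N \<omega>. matrix_inv (D' N \<omega>) ** matrix_inv (D N \<omega>) ** \<Phi>_hat N \<omega>
             ** transpose (matrix_inv (D N \<omega>)) ** transpose (matrix_inv (D' N \<omega>))) \<Phi>_star"
proof -
  interpret prob_space M by fact
  define S where "S = L_star ** \<Phi>_star ** transpose L_star"
  define F :: "((real ^ 'k ^ 'k) \<times> (real ^ 'k ^ 'k)) set" where "F = signed_permutations"
  note A_meas = assms(8) and L_meas = assms(16) and \<Phi>_meas = assms(17) and min = assms(18)
  have unique: "\<exists>d\<in>signed_permutations. aligned_loadings L d = L_star \<and> aligned_cov \<Phi> d = \<Phi>_star"
    if "Q_p_minimiser p S L \<Phi>" for L \<Phi>
  proof (cases "(L, \<Phi>) = (L_star, \<Phi>_star)")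
    case True
    then show ?thesis using identity_in_signed_permutations aligned_identity by blast
  next
    case False
    then show ?thesis
      using C3(2)[OF that[unfolded S_def]]
      by (auto simp: signed_permutations_def aligned_loadings_def aligned_cov_def)
  qed
  have "\<exists>s. s \<in> M \<rightarrow>\<^sub>M count_space F \<and> (\<forall>\<omega>\<in>space M. s \<omega> \<in> F) \<and>
      (\<forall>\<omega>. \<forall>d\<in>F. misalignment L_star \<Phi>_star (L_hat N \<omega>) (\<Phi>_hat N \<omega>) (s \<omega>)
        \<le> misalignment L_star \<Phi>_star (L_hat N \<omega>) (\<Phi>_hat N \<omega>) d)" for N
  proof -
    \<comment> \<open>Each fixed \<open>d\<close> gives a continuous function of the two
      estimators.\<close>
    have meas: "(\<lambda>\<omega>. misalignment L_star \<Phi>_star (L_hat N \<omega>) (\<Phi>_hat N \<omega>) d) \<in> borel_measurable M" for d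
    proof -
      have "(\<lambda>L. dist (aligned_loadings L d) L_star) \<in> borel_measurable borel"
        unfolding aligned_loadings_def
        by (intro borel_measurable_continuous_onI continuous_intros)
      moreover have "(\<lambda>\<Phi>. dist (aligned_cov \<Phi> d) \<Phi>_star) \<in> borel_measurable borel"
        unfolding aligned_cov_def
        by (intro borel_measurable_continuous_onI continuous_intros)
      ultimately show ?thesis unfolding misalignment_def
        using measurable_compose[OF L_meas] measurable_compose[OF \<Phi>_meas]
        by (intro borel_measurable_add) blast+
    qed
    show ?thesis
    proof (rule measurable_finite_argmin[of F
          "\<lambda>d \<omega>. misalignment L_star \<Phi>_star (L_hat N \<omega>) (\<Phi>_hat N \<omega>) d" M])
      show "finite F" "F \<noteq> {}"
        using finite_signed_permutations identity_in_signed_permutations by (auto simp: F_def)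
    qed (use meas in blast)+
  qed
  then obtain s where s: "\<And>N. s N \<in> M \<rightarrow>\<^sub>M count_space F"
    and sF: "\<And>N \<omega>. \<omega> \<in> space M \<Longrightarrow> s N \<omega> \<in> F"
    and smin: "\<And>N \<omega> d. d \<in> F \<Longrightarrow>
      misalignment L_star \<Phi>_star (L_hat N \<omega>) (\<Phi>_hat N \<omega>) (s N \<omega>)
        \<le> misalignment L_star \<Phi>_star (L_hat N \<omega>) (\<Phi>_hat N \<omega>) d"
    by metis
  \<comment> \<open>Stated for any \<open>X\<close> below the optimal misalignment, so that it
    serves both the loading error and the covariance error.\<close>
  have conv: "(\<lambda>N. measure M {\<omega> \<in> space M. X N \<omega> > \<epsilon>}) \<longlonglongrightarrow> 0"
    if X: "\<And>N \<omega>. X N \<omega> \<le> misalignment L_star \<Phi>_star (L_hat N \<omega>) (\<Phi>_hat N \<omega>) (s N \<omega>)"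
      and "\<epsilon> > 0" for X :: "nat \<Rightarrow> 'w \<Rightarrow> real" and \<epsilon>
  proof -
    obtain \<delta> where "\<delta> > 0" and \<delta>: "\<And>(A :: real ^ 'k ^ 'j) L \<Phi>. dist (A ** transpose A) S \<le> \<delta> \<Longrightarrow>
        Q_p_minimiser p (A ** transpose A) L \<Phi> \<Longrightarrow>
        \<exists>d\<in>F. misalignment L_star \<Phi>_star L \<Phi> d \<le> \<epsilon>"
      using Q_p_minimiser_stable[OF assms(2) C2 C3(1) unique[unfolded S_def] \<open>\<epsilon> > 0\<close>]
      unfolding S_def F_def by blast
    have le: "measure M {\<omega> \<in> space M. X N \<omega> > \<epsilon>}
        \<le> measure M {\<omega> \<in> space M. dist (A_hat N \<omega> ** transpose (A_hat N \<omega>)) S > \<delta>}" for N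
    \<comment> \<open>The inclusion of events holds up to a null set, because minimality is only
      almost sure. \<open>X\<close> carries no measurability, so the comparison rests on that of the
      larger event.\<close>
    proof (rule finite_measure_mono_AE)
      show "AE \<omega> in M. \<omega> \<in> {\<omega> \<in> space M. X N \<omega> > \<epsilon>} \<longrightarrow>
          \<omega> \<in> {\<omega> \<in> space M. dist (A_hat N \<omega> ** transpose (A_hat N \<omega>)) S > \<delta>}"
        using min[of N]
      proof eventually_elim
        case (elim \<omega>)
        \<comment> \<open>Stability provides some good alignment, and the selected one is at least
          as good.\<close>
        have "X N \<omega> \<le> \<epsilon>" if "dist (A_hat N \<omega> ** transpose (A_hat N \<omega>)) S \<le> \<delta>"
          using \<delta>[OF that elim] smin X by (meson order_trans)
        then show ?case by force
      qed
      have "(\<lambda>A :: real ^ 'k ^ 'j. dist (A ** transpose A) S) \<in> borel_measurable borel"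
        by (intro borel_measurable_continuous_onI continuous_intros)
      from measurable_compose[OF A_meas this]
      show "{\<omega> \<in> space M. dist (A_hat N \<omega> ** transpose (A_hat N \<omega>)) S > \<delta>} \<in> sets M"
        by measurable
    qed
    have lim: "(\<lambda>N. measure M {\<omega> \<in> space M. dist (A_hat N \<omega> ** transpose (A_hat N \<omega>)) S > \<delta>}) \<longlonglongrightarrow> 0"
      using C1(1) \<open>\<delta> > 0\<close> by (auto simp: conv_in_prob_def S_def)
    show ?thesis
      by (rule real_tendsto_sandwich[OF _ _ tendsto_const lim]) (use le in auto)
  qed
  show ?thesis
  proof (rule exI[of _ "\<lambda>N \<omega>. fst (s N \<omega>)"], rule exI[of _ "\<lambda>N \<omega>. snd (s N \<omega>)"],
      intro conjI allI ballI)
    show "(\<lambda>\<omega>. fst (s N \<omega>)) \<in> borel_measurable M" "(\<lambda>\<omega>. snd (s N \<omega>)) \<in> borel_measurable M" for N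
      \<comment> \<open>Every function on the discrete space \<open>count_space F\<close> is
        measurable, in particular both projections.\<close>
      by (rule measurable_compose[OF s]; simp)+
    show "fst (s N \<omega>) \<in> permutation_matrices" "snd (s N \<omega>) \<in> sign_flip_matrices"
      if "\<omega> \<in> space M" for N \<omega>
      using sF[OF that, of N] by (auto simp: F_def signed_permutations_def)
    show "conv_in_prob M (\<lambda>N \<omega>. L_hat N \<omega> ** fst (s N \<omega>) ** snd (s N \<omega>)) L_star"
      unfolding conv_in_prob_def
      by (intro allI impI conv) (auto simp: misalignment_def aligned_loadings_def)
    show "conv_in_prob M (\<lambda>N \<omega>. matrix_inv (snd (s N \<omega>)) ** matrix_inv (fst (s N \<omega>)) ** \<Phi>_hat N \<omega>
             ** transpose (matrix_inv (fst (s N \<omega>))) ** transpose (matrix_inv (snd (s N \<omega>)))) \<Phi>_star"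
      unfolding conv_in_prob_def
      by (intro allI impI conv) (auto simp: misalignment_def aligned_cov_def)
  qed
qed

end
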